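(* Let $k\ge2$ be an integer, let $T$ be the infinite rooted $k$-ary tree, let $\delta\in\left(\frac12,1\right)$ and $$w(x)=\sum_{j=0}^{\infty}\frac{1}{k^{\delta j}}\chi_{T_{j}}(x).$$ Then for every $1<q<\infty$ and all functions $f$ on $T$ $$\|Mf\|_{L^{q}(w)}\lesssim\|f\|_{L^{q}(w)},$$ but also, for every $1<p<\infty$, $$\sup_{x\in T,\,r>0}\left(\frac{1}{|S(x,r)|}\sum_{y\in S(x,r)}w(y)\right)\left(\frac{1}{|S(x,r)|}\sum_{y\in S(x,r)}w(y)^{-\frac{1}{p-1}}\right)^{p-1}=\infty,$$ where $r$ ranges over the positive integers.
   Context: For an integer $k\ge2$, $T$ denotes (the vertex set of) the infinite rooted $k$-ary tree, in which every vertex has exactly $k$ children; $d(x,y)$ is the number of edges on the unique path between $x$ and $y$. $T_0$ is the set consisting of the root, and $T_j$ is the set of children of vertices in $T_{j-1}$ for $j\ge1$; $\chi_A$ is the indicator function of $A$. $|A|$ is the cardinality of $A$, $B(x,r)=\{y\in T: d(x,y)\le r\}$ and $S(x,r)=\{y\in T:d(x,y)=r\}$. The centered maximal function is $Mf(x)=\sup_{r\in\mathbb{N}\cup\{0\}}\frac{1}{|B(x,r)|}\sum_{y\in B(x,r)}|f(y)|$. $\|f\|_{L^q(w)}=\left(\sum_{x\in T}|f(x)|^q w(x)\right)^{1/q}$. The notation $A\lesssim B$ means $A\le CB$ for a finite constant $C$ independent of $f$. *)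

theory Defs
  imports "HOL-Analysis.Analysis"
begin

text \<open>
  A vertex of the infinite rooted \<open>k\<close>-ary tree is the list of choices leading to it from the root,
  most recent choice first: the root is \<open>[]\<close>, the children of \<open>x\<close> are \<open>i # x\<close> with \<open>i < k\<close>.
\<close>

type_synonym vertex = "nat list"

definition tree :: "nat \<Rightarrow> vertex set" where
  "tree k = lists {..<k}"

definition children :: "nat \<Rightarrow> vertex \<Rightarrow> vertex set" where
  "children k x = {i # x | i. i < k}"

primrec level :: "nat \<Rightarrow> nat \<Rightarrow> vertex set" where
  "level k 0 = {[]}"
| "level k (Suc j) = (\<Union>x\<in>level k j. children k x)"

definition adjacent :: "nat \<Rightarrow> vertex \<Rightarrow> vertex \<Rightarrow> bool" where
  "adjacent k x y \<longleftrightarrow> y \<in> children k x \<or> x \<in> children k y"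

definition is_path :: "nat \<Rightarrow> vertex \<Rightarrow> vertex \<Rightarrow> vertex list \<Rightarrow> bool" where
  "is_path k x y p \<longleftrightarrow>
     p \<noteq> [] \<and> hd p = x \<and> last p = y \<and> set p \<subseteq> tree k \<and> distinct p \<and> successively (adjacent k) p"

definition tdist :: "nat \<Rightarrow> vertex \<Rightarrow> vertex \<Rightarrow> nat" where
  "tdist k x y = length (THE p. is_path k x y p) - 1"

definition tball :: "nat \<Rightarrow> vertex \<Rightarrow> nat \<Rightarrow> vertex set" where
  "tball k x r = {y \<in> tree k. tdist k x y \<le> r}"

definition tsphere :: "nat \<Rightarrow> vertex \<Rightarrow> nat \<Rightarrow> vertex set" where
  "tsphere k x r = {y \<in> tree k. tdist k x y = r}"

definition maximal_fun :: "nat \<Rightarrow> (vertex \<Rightarrow> complex) \<Rightarrow> vertex \<Rightarrow> ennreal" where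
  "maximal_fun k f x =
     (SUP r. ennreal (1 / real (card (tball k x r)) * (\<Sum>y\<in>tball k x r. cmod (f y))))"

text \<open>Only used for exponents \<open>s > 0\<close>, where \<open>\<infinity>\<close> raised to \<open>s\<close> is \<open>\<infinity>\<close>.\<close>

definition ennpow :: "ennreal \<Rightarrow> real \<Rightarrow> ennreal" where
  "ennpow a s = (if a = \<infinity> then \<infinity> else ennreal (enn2real a powr s))"

text \<open>
  The weighted norm takes the modulus of a function, with values in \<open>[0,\<infinity>]\<close>, since the maximal
  function may be infinite; the norm is \<open>\<infinity>\<close> for functions outside the weighted space.
\<close>

definition Lnorm :: "nat \<Rightarrow> real \<Rightarrow> (vertex \<Rightarrow> real) \<Rightarrow> (vertex \<Rightarrow> ennreal) \<Rightarrow> ennreal" where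
  "Lnorm k q w g = ennpow (\<Sum>\<^sub>\<infinity>x\<in>tree k. ennpow (g x) q * ennreal (w x)) (1 / q)"

definition weight :: "nat \<Rightarrow> real \<Rightarrow> vertex \<Rightarrow> real" where
  "weight k \<delta> x = (\<Sum>j. 1 / real k powr (\<delta> * real j) * indicator (level k j) x)"

definition sphere_avg :: "nat \<Rightarrow> vertex \<Rightarrow> nat \<Rightarrow> (vertex \<Rightarrow> real) \<Rightarrow> real" where
  "sphere_avg k x r g = 1 / real (card (tsphere k x r)) * (\<Sum>y\<in>tsphere k x r. g y)"

end

theory Submission
  imports Defs "HOL-Library.Sublist"
begin

text \<open>
  Boundedness needs no maximal theorem. A ball of radius \<open>r\<close> has at least \<open>k ^ r\<close> vertices, so by
  Jensen's inequality every average obeys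
  \<open>(avg |f|)^q \<le> avg |f|^q \<le> (\<Sum>y. |f y|^q / k ^ d(x,y))\<close>, and hence so does \<open>(Mf x)^q\<close>. It remains to bound
  \<open>(\<Sum>x. w x / k ^ d(x,y))\<close> by a multiple of \<open>w y\<close>: going \<open>i\<close> steps up from \<open>y\<close> and then \<open>j\<close> steps
  down reaches at most \<open>k ^ j\<close> vertices, of weight \<open>w y * k powr (\<delta> * (i - j))\<close>, so the sum splits into two
  geometric series with ratios \<open>k powr (\<delta> - 1)\<close> and \<open>k powr (- \<delta>)\<close>.

  For the second claim take \<open>x\<close> at level \<open>n\<close> and \<open>r = n\<close>. The sphere has at most \<open>2 * k ^ n\<close> points; the
  root contributes 1 to the sum of \<open>w\<close>, and the \<open>k ^ n\<close> descendants at level \<open>2 * n\<close> make the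
  second factor at least a constant times \<open>k powr (2 * \<delta> * n)\<close>. The product grows like
  \<open>k powr ((2 * \<delta> - 1) * n)\<close>.
\<close>

section \<open>Vertices as lists, and the levels of the tree\<close>

lemma tree_Cons_iff [simp]: "i # x \<in> tree k \<longleftrightarrow> i < k \<and> x \<in> tree k"
  by (auto simp: tree_def)

lemma tree_Nil [simp]: "[] \<in> tree k"
  by (simp add: tree_def)

lemma tree_append_iff [simp]: "u @ x \<in> tree k \<longleftrightarrow> u \<in> tree k \<and> x \<in> tree k"
  by (simp add: tree_def)

lemma tree_tl: "x \<in> tree k \<Longrightarrow> tl x \<in> tree k"
  by (cases x) auto

lemma tree_drop: "x \<in> tree k \<Longrightarrow> drop i x \<in> tree k"
  by (metis append_take_drop_id tree_append_iff)

lemma tree_take: "x \<in> tree k \<Longrightarrow> take i x \<in> tree k"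
  by (metis append_take_drop_id tree_append_iff)

lemma level_eq: "level k j = {x \<in> tree k. length x = j}"
proof (induction j)
  case (Suc j)
  show ?case
    unfolding level.simps Suc children_def by (auto simp: length_Suc_conv)
qed auto

lemma finite_level [simp]: "finite (level k j)"
  using finite_lists_length_eq[of "{..<k}" j]
  by (simp add: level_eq tree_def lists_eq_set)

lemma card_level: "card (level k j) = k ^ j"
  using card_lists_length_eq[of "{..<k}" j]
  by (simp add: level_eq tree_def lists_eq_set)

section \<open>Existence and uniqueness of paths\<close>

lemma adjacent_sym: "adjacent k x y \<longleftrightarrow> adjacent k y x"
  by (auto simp: adjacent_def)

lemma is_path_rev: "is_path k x y p \<Longrightarrow> is_path k y x (rev p)"
  by (auto simp: is_path_def hd_rev last_rev adjacent_sym)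

text \<open>A walk leaves the subtree below \<open>s\<close> only through the parent of \<open>s\<close>.\<close>

lemma walk_stays_in_subtree:
  assumes "successively (adjacent k) l" "l \<noteq> []" "suffix s (hd l)" "s \<noteq> []" "tl s \<notin> set l"
  shows "suffix s (last l)"
  using assms
proof (induction l)
  case (Cons a l)
  show ?case
  proof (cases l)
    case Nil
    then show ?thesis using Cons.prems by simp
  next
    case (Cons b l')
    have ab: "adjacent k a b" and sa: "suffix s a" and nb: "tl s \<noteq> b"
      using Cons.prems Cons by auto
    have "suffix s b"
      using ab sa nb \<open>s \<noteq> []\<close>
      by (auto simp: adjacent_def children_def suffix_Cons)
    then show ?thesis
      using Cons.IH Cons.prems Cons by auto
  qed
qed simp

text \<open>The suffix clause serves the induction: it shows that prepending a longer vertex repeats none.\<close>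

definition geodesic :: "nat \<Rightarrow> vertex \<Rightarrow> vertex \<Rightarrow> vertex list \<Rightarrow> bool" where
  "geodesic k x y p \<longleftrightarrow>
     is_path k x y p \<and> (\<forall>q. is_path k x y q \<longrightarrow> q = p) \<and>
     (\<forall>z\<in>set p. suffix z x \<or> suffix z y) \<and>
     (\<exists>i\<le>length x. \<exists>j\<le>length y. drop i x = drop j y \<and> length p = Suc (i + j) \<and>
        (\<forall>i'\<le>length x. \<forall>j'\<le>length y. drop i' x = drop j' y \<longrightarrow> i + j \<le> i' + j'))"

text \<open>By this symmetry, the induction in \<open>geodesic_exists\<close> only has to move the
  deeper endpoint, whichever of the two it is.\<close>

lemma geodesic_rev:
  assumes "geodesic k x y p"
  shows "geodesic k y x (rev p)"
proof -
  obtain i j where ij: "i \<le> length x" "j \<le> length y" "drop i x = drop j y" "length p = Suc (i + j)"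
    "\<forall>i'\<le>length x. \<forall>j'\<le>length y. drop i' x = drop j' y \<longrightarrow> i + j \<le> i' + j'"
    using assms unfolding geodesic_def by auto
  have "j + i \<le> i' + j'" if "i' \<le> length y" "j' \<le> length x" "drop i' y = drop j' x" for i' j'
    using ij(5)[rule_format, of j' i'] that by simp
  then have E: "\<exists>i\<le>length y. \<exists>j\<le>length x. drop i y = drop j x \<and> length (rev p) = Suc (i + j) \<and>
        (\<forall>i'\<le>length y. \<forall>j'\<le>length x. drop i' y = drop j' x \<longrightarrow> i + j \<le> i' + j')"
    using ij(1-2) ij(3)[symmetric] ij(4) by (metis add.commute length_rev)
  have p: "is_path k x y p" and uniq: "\<And>q. is_path k x y q \<Longrightarrow> q = p"
    and suf: "\<And>z. z \<in> set p \<Longrightarrow> suffix z x \<or> suffix z y"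
    using assms unfolding geodesic_def by blast+
  have "q = rev p" if "is_path k y x q" for q
    using uniq[OF is_path_rev[OF that]] by auto
  moreover have "suffix z y \<or> suffix z x" if "z \<in> set (rev p)" for z
    using suf[of z] that by auto
  ultimately show ?thesis
    unfolding geodesic_def by (intro conjI allI impI ballI is_path_rev[OF p] E)
qed

lemma geodesic_refl:
  assumes "x \<in> tree k"
  shows "geodesic k x x [x]"
proof -
  have "q = [x]" if "is_path k x x q" for q
    using that by (cases q) (auto simp: is_path_def split: if_splits)
  moreover have "is_path k x x [x]"
    using assms by (simp add: is_path_def)
  moreover have "\<exists>i\<le>length x. \<exists>j\<le>length x. drop i x = drop j x \<and> length [x] = Suc (i + j) \<and>
        (\<forall>i'\<le>length x. \<forall>j'\<le>length x. drop i' x = drop j' x \<longrightarrow> i + j \<le> i' + j')"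
    by (intro exI[of _ 0] conjI) simp_all
  moreover have "\<forall>z\<in>set [x]. suffix z x \<or> suffix z x"
    by simp
  ultimately show ?thesis
    unfolding geodesic_def by (intro conjI allI impI)
qed

text \<open>As \<open>y\<close> is no deeper than \<open>x\<close> and differs from it, a path from
  \<open>x\<close> to \<open>y\<close> must begin with the step to the parent: a first step to a
  child would confine it below that child, since \<open>x\<close> cannot be revisited, and
  \<open>y\<close> is too shallow to lie there.\<close>

lemma geodesic_Cons:
  assumes x: "x \<in> tree k" and len: "length y \<le> length x" and "x \<noteq> y"
    and g: "geodesic k (tl x) y p"
  shows "geodesic k x y (x # p)"
proof -
  obtain a x' where xa: "x = a # x'"
    using len \<open>x \<noteq> y\<close> by (cases x) auto
  note g = g[unfolded xa list.sel geodesic_def]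
  have p: "is_path k x' y p" and puniq: "\<And>q. is_path k x' y q \<Longrightarrow> q = p"
    and psuf: "\<And>z. z \<in> set p \<Longrightarrow> suffix z x' \<or> suffix z y"
    using g by blast+
  obtain i j where ij: "i \<le> length x'" "j \<le> length y" "drop i x' = drop j y" "length p = Suc (i + j)"
    and ijmin: "\<forall>i'\<le>length x'. \<forall>j'\<le>length y. drop i' x' = drop j' y \<longrightarrow> i + j \<le> i' + j'"
    using g by (elim conjE exE)
  \<comment> \<open>\<open>x\<close> is longer than its parent and could be a suffix of
    \<open>y\<close> only by equalling it, so the suffix clause for \<open>p\<close> rules it
    out.\<close>
  have "x \<notin> set p"
  proof
    assume "x \<in> set p"
    then have "suffix x x' \<or> suffix x y" by (rule psuf)
    then show False
      using len \<open>x \<noteq> y\<close> xa by (auto simp: suffix_def)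
  qed
  have 1: "is_path k x y (x # p)"
    using p x \<open>x \<notin> set p\<close> unfolding is_path_def xa
    by (auto simp: successively_Cons adjacent_def children_def)
  have 2: "q = x # p" if q: "is_path k x y q" for q
  proof -
    obtain q' where q': "q = x # q'"
      using q by (cases q) (auto simp: is_path_def)
    have ne: "q' \<noteq> []" using q q' \<open>x \<noteq> y\<close> by (auto simp: is_path_def)
    have adj: "adjacent k x (hd q')" and suc: "successively (adjacent k) q'"
      and nx: "x \<notin> set q'" and ly: "last q' = y"
      using q q' ne by (auto simp: is_path_def successively_Cons)
    have "hd q' = x'"
    proof (rule ccontr)
      assume "hd q' \<noteq> x'"
      then obtain c where "hd q' = c # x"
        using adj xa by (auto simp: adjacent_def children_def)
      then have "suffix (c # x) (last q')"
        by (intro walk_stays_in_subtree[OF suc ne]) (auto simp: nx)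
      then show False
        using ly len by (auto simp: suffix_def)
    qed
    then have "is_path k x' y q'"
      using q q' ne by (auto simp: is_path_def successively_Cons)
    then show ?thesis using puniq q' by simp
  qed
  have 3: "suffix z x \<or> suffix z y" if "z \<in> set (x # p)" for z
    using that psuf xa by (auto intro: suffix_ConsI)
  \<comment> \<open>A competitor with \<open>i' = 0\<close> would make \<open>x\<close> a suffix of
    \<open>y\<close>, hence equal to it. Otherwise, omitting its first upward step gives a
    competitor for the parent of \<open>x\<close>.\<close>
  have 4: "Suc i + j \<le> i' + j'"
    if "i' \<le> length x" "j' \<le> length y" "drop i' x = drop j' y" for i' j'
  proof (cases i')
    case 0
    then have "x = drop j' y" using that by simp
    then have "length x = length y - j'" by simp
    then have "j' = 0" using len that xa by auto
    then show ?thesis using \<open>x = drop j' y\<close> \<open>x \<noteq> y\<close> by simp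
  next
    case (Suc i'')
    then show ?thesis using ijmin[rule_format, of i'' j'] that xa by auto
  qed
  have "\<exists>i\<le>length x. \<exists>j\<le>length y. drop i x = drop j y \<and> length (x # p) = Suc (i + j) \<and>
        (\<forall>i'\<le>length x. \<forall>j'\<le>length y. drop i' x = drop j' y \<longrightarrow> i + j \<le> i' + j')"
    using ij 4 xa by (intro exI[of _ "Suc i"] conjI exI[of _ j] allI impI) simp_all
  then show ?thesis
    unfolding geodesic_def by (intro conjI allI impI ballI 1 2 3)
qed

lemma geodesic_exists:
  assumes "x \<in> tree k" "y \<in> tree k"
  shows "\<exists>p. geodesic k x y p"
  using assms
proof (induction "length x + length y" arbitrary: x y rule: less_induct)
  case less
  consider "x = y" | "x \<noteq> y" "length y \<le> length x" | "x \<noteq> y" "length x \<le> length y"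
    by linarith
  then show ?case
  proof cases
    case 1
    then show ?thesis using geodesic_refl less.prems by blast
  next
    case 2
    then have "x \<noteq> []" by auto
    then have "\<exists>p. geodesic k (tl x) y p"
      by (intro less.hyps) (use less.prems in \<open>auto simp: tree_tl\<close>)
    then show ?thesis
      using geodesic_Cons 2 less.prems by blast
  next
    case 3
    then have "y \<noteq> []" by auto
    then have "\<exists>p. geodesic k (tl y) x p"
      by (intro less.hyps) (use less.prems in \<open>auto simp: tree_tl\<close>)
    then show ?thesis
      using geodesic_Cons[of y k x] geodesic_rev 3 less.prems by metis
  qed
qed

section \<open>The distance in terms of common ancestors\<close>

text \<open>Uniqueness of the path evaluates the \<open>THE\<close> in \<open>tdist\<close>. From
  here on the distance is the least number of upward steps from both vertices to a common ancestor,
  and paths do not occur again.\<close>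

lemma tdist_eq_steps:
  assumes "x \<in> tree k" "y \<in> tree k"
  shows "\<exists>i\<le>length x. \<exists>j\<le>length y. drop i x = drop j y \<and> tdist k x y = i + j \<and>
           (\<forall>i'\<le>length x. \<forall>j'\<le>length y. drop i' x = drop j' y \<longrightarrow> i + j \<le> i' + j')"
proof -
  obtain p where p: "geodesic k x y p"
    using geodesic_exists assms by blast
  then have "(THE p. is_path k x y p) = p"
    unfolding geodesic_def by blast
  moreover have "p \<noteq> []"
    using p unfolding geodesic_def is_path_def by blast
  \<comment> \<open>A path with n edges lists n + 1 vertices; as \<open>p\<close> is nonempty, the
    truncated subtraction in \<open>tdist\<close> loses nothing.\<close>
  ultimately have len: "length p = Suc n \<longleftrightarrow> tdist k x y = n" for n
    unfolding tdist_def by (cases p) auto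
  have "\<exists>i\<le>length x. \<exists>j\<le>length y. drop i x = drop j y \<and> length p = Suc (i + j) \<and>
      (\<forall>i'\<le>length x. \<forall>j'\<le>length y. drop i' x = drop j' y \<longrightarrow> i + j \<le> i' + j')"
    using p unfolding geodesic_def by (elim conjE)
  then show ?thesis
    unfolding len .
qed

text \<open>The form used for counting: climb \<open>i\<close> edges from \<open>x\<close>, then
  descend along \<open>u\<close>.\<close>

lemma tdist_obtain:
  assumes "x \<in> tree k" "y \<in> tree k"
  obtains i u where "i \<le> length x" "u \<in> tree k" "y = u @ drop i x" "tdist k x y = i + length u"
proof -
  obtain i j where "i \<le> length x" "j \<le> length y" "drop i x = drop j y" "tdist k x y = i + j"
    using tdist_eq_steps[OF assms] by (elim exE conjE)
  then show ?thesis
    using that[of i "take j y"] tree_take[OF assms(2), of j] append_take_drop_id[of j y]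
    by (simp del: append_take_drop_id)
qed

text \<open>The descent along \<open>u\<close> may retrace part of the climb, hence only an
  inequality; it follows from minimality in \<open>tdist_eq_steps\<close>.\<close>

lemma tdist_le:
  assumes "x \<in> tree k" "u \<in> tree k" "i \<le> length x"
  shows "tdist k x (u @ drop i x) \<le> i + length u"
proof -
  have y: "u @ drop i x \<in> tree k"
    using assms tree_drop by simp
  obtain a b where "tdist k x (u @ drop i x) = a + b" and
    min: "\<forall>i'\<le>length x. \<forall>j'\<le>length (u @ drop i x).
            drop i' x = drop j' (u @ drop i x) \<longrightarrow> a + b \<le> i' + j'"
    using tdist_eq_steps[OF assms(1) y] by (elim exE conjE)
  with min[rule_format, of i "length u"] assms show ?thesis by simp
qed

lemma tdist_commute:
  assumes "x \<in> tree k" "y \<in> tree k"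
  shows "tdist k x y = tdist k y x"
proof -
  have "tdist k y x \<le> tdist k x y" if xy: "x \<in> tree k" "y \<in> tree k" for x y
  proof -
    obtain i j where ij: "i \<le> length x" "j \<le> length y" "drop i x = drop j y" "tdist k x y = i + j"
      using tdist_eq_steps[OF xy] by (elim exE conjE)
    then have "x = take i x @ drop j y"
      using append_take_drop_id[of i x] by (simp del: append_take_drop_id)
    moreover have "length (take i x) = i"
      using ij by simp
    ultimately show ?thesis
      using tdist_le[OF xy(2) tree_take[OF xy(1), of i] ij(2)] ij by (simp add: add.commute)
  qed
  then show ?thesis
    using assms by (meson antisym)
qed

lemma tdist_ge_length_diff:
  assumes "x \<in> tree k" "y \<in> tree k"
  shows "length y \<le> length x + tdist k x y" "length x \<le> length y + tdist k x y"
proof -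
  obtain i u where "i \<le> length x" "u \<in> tree k" "y = u @ drop i x" "tdist k x y = i + length u"
    by (rule tdist_obtain[OF assms])
  then show "length y \<le> length x + tdist k x y" "length x \<le> length y + tdist k x y"
    by auto
qed

lemma tdist_root:
  assumes "x \<in> tree k"
  shows "tdist k x [] = length x"
proof (rule antisym)
  show "tdist k x [] \<le> length x"
    using tdist_le[OF assms tree_Nil, of "length x"] by simp
  show "length x \<le> tdist k x []"
    using tdist_ge_length_diff(2)[OF assms tree_Nil] by simp
qed

lemma tdist_descendant:
  assumes "x \<in> tree k" "u \<in> tree k"
  shows "tdist k x (u @ x) = length u"
proof (rule antisym)
  show "tdist k x (u @ x) \<le> length u"
    using tdist_le[OF assms, of 0] by simp
  show "length u \<le> tdist k x (u @ x)"
    using tdist_ge_length_diff(1)[of x k "u @ x"] assms by simp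
qed

section \<open>Finiteness and cardinality of balls and spheres\<close>

lemma tball_subset:
  assumes "x \<in> tree k"
  shows "tball k x r \<subseteq> (\<lambda>(i, u). u @ drop i x) ` ({..r} \<times> (\<Union>j\<le>r. level k j))"
proof
  fix y assume y: "y \<in> tball k x r"
  then have "y \<in> tree k" by (simp add: tball_def)
    obtain i u where "i \<le> length x" "u \<in> tree k" "y = u @ drop i x" "tdist k x y = i + length u"
      by (rule tdist_obtain[OF assms \<open>y \<in> tree k\<close>])
    moreover have "tdist k x y \<le> r"
      using y by (simp add: tball_def)
  ultimately show "y \<in> (\<lambda>(i, u). u @ drop i x) ` ({..r} \<times> (\<Union>j\<le>r. level k j))"
    by (intro image_eqI[of _ _ "(i, u)"]) (auto simp: level_eq)
qed

lemma finite_tball: "x \<in> tree k \<Longrightarrow> finite (tball k x r)"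
  by (rule finite_subset[OF tball_subset]) auto

lemma finite_tsphere: "x \<in> tree k \<Longrightarrow> finite (tsphere k x r)"
  by (rule finite_subset[OF _ finite_tball[of x k r]]) (auto simp: tsphere_def tball_def)

text \<open>Serves both halves of the theorem: it bounds ball sizes from below, and it supplies the
  light vertices that make the second sphere average large.\<close>

lemma descendants_subset_tsphere:
  "x \<in> tree k \<Longrightarrow> (\<lambda>u. u @ x) ` level k r \<subseteq> tsphere k x r"
  by (auto simp: tsphere_def level_eq tdist_descendant)

lemma card_descendants: "card ((\<lambda>u. u @ x) ` level k r) = k ^ r"
  by (subst card_image) (auto simp: inj_on_def card_level)

lemma card_tball_ge:
  assumes "x \<in> tree k"
  shows "k ^ r \<le> card (tball k x r)"
proof -
  have "(\<lambda>u. u @ x) ` level k r \<subseteq> tball k x r"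
    using descendants_subset_tsphere[OF assms, of r] by (auto simp: tsphere_def tball_def)
  then show ?thesis
    using card_mono[OF finite_tball[OF assms]] by (metis card_descendants)
qed

lemma sum_powers_le: 
  fixes k :: nat
  assumes "2 \<le> k"
  shows "(\<Sum>i\<le>r. k ^ i) \<le> 2 * k ^ r"
proof (induction r)
  case (Suc r)
  have "2 * k ^ r \<le> k * k ^ r" using assms by (rule mult_right_mono) simp
  then have "(\<Sum>i\<le>r. k ^ i) \<le> k * k ^ r" using Suc by linarith
  then show ?case by simp
qed simp

text \<open>Climbing \<open>i\<close> edges and descending \<open>r - i\<close> gives at most
  \<open>k ^ (r - i)\<close> endpoints. Overlaps, and values of \<open>i\<close> beyond the depth of
  \<open>x\<close>, only enlarge the cover; the geometric sum costs the factor 2.\<close>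

lemma card_tsphere_le:
  assumes "2 \<le> k" "x \<in> tree k"
  shows "card (tsphere k x r) \<le> 2 * k ^ r"
proof -
  have "tsphere k x r \<subseteq> (\<Union>i\<le>r. (\<lambda>u. u @ drop i x) ` level k (r - i))"
  proof
    fix y assume y: "y \<in> tsphere k x r"
    then have "y \<in> tree k" by (simp add: tsphere_def)
    obtain i u where "i \<le> length x" "u \<in> tree k" "y = u @ drop i x" "tdist k x y = i + length u"
      by (rule tdist_obtain[OF assms(2) \<open>y \<in> tree k\<close>])
    moreover have "tdist k x y = r"
      using y by (simp add: tsphere_def)
    ultimately show "y \<in> (\<Union>i\<le>r. (\<lambda>u. u @ drop i x) ` level k (r - i))"
      by (auto simp: level_eq image_iff intro!: bexI[of _ i])
  qed
  then have "card (tsphere k x r) \<le> card (\<Union>i\<le>r. (\<lambda>u. u @ drop i x) ` level k (r - i))"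
    by (intro card_mono) auto
  also have "\<dots> \<le> (\<Sum>i\<le>r. card ((\<lambda>u. u @ drop i x) ` level k (r - i)))"
    by (intro card_UN_le) auto
  also have "\<dots> = (\<Sum>i\<le>r. k ^ (r - i))"
    by (simp add: card_descendants)
  also have "\<dots> = (\<Sum>i\<le>r. k ^ i)"
    by (rule sum.nat_diff_reindex[of _ "Suc r", unfolded lessThan_Suc_atMost, simplified])
  also have "\<dots> \<le> 2 * k ^ r"
    by (rule sum_powers_le[OF assms(1)])
  finally show ?thesis .
qed

section \<open>The weight in closed form, and powers of ball averages\<close>

text \<open>The levels are disjoint, so the defining series has a single nonzero term.\<close>

lemma weight_eq:
  assumes "x \<in> tree k"
  shows "weight k \<delta> x = real k powr (- \<delta> * real (length x))"
proof -
  have "(\<lambda>j. 1 / real k powr (\<delta> * real j) * indicator (level k j) x) =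
        (\<lambda>j. if j = length x then 1 / real k powr (\<delta> * real j) else 0)"
    using assms by (auto simp: level_eq fun_eq_iff)
  then have "weight k \<delta> x = 1 / real k powr (\<delta> * real (length x))"
    unfolding weight_def using sums_single[of "length x" "\<lambda>j. 1 / real k powr (\<delta> * real j)"]
    by (simp add: sums_iff)
  then show ?thesis by (simp add: powr_minus_divide)
qed

text \<open>Young's inequality applied to each \<open>a i * A powr (q - 1)\<close>, where \<open>A\<close> is the mean.\<close>

lemma mean_powr_le:
  fixes a :: "'a \<Rightarrow> real"
  assumes "finite S" "S \<noteq> {}" "1 < q" and nonneg: "\<And>i. i \<in> S \<Longrightarrow> 0 \<le> a i"
  shows "((\<Sum>i\<in>S. a i) / real (card S)) powr q \<le> (\<Sum>i\<in>S. a i powr q) / real (card S)"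
proof -
  define n where "n = real (card S)"
  have n: "n > 0" using assms by (simp add: n_def card_gt_0_iff)
  define A where "A = (\<Sum>i\<in>S. a i) / n"
  have A: "A \<ge> 0" using n nonneg by (simp add: A_def sum_nonneg)
  define q' where "q' = q / (q - 1)"
  \<comment> \<open>The third identity makes the second term in Young's inequality equal to
    \<open>A powr q / q'\<close>.\<close>
  have q': "q' > 1" "1 / q + 1 / q' = 1" "(q - 1) * q' = q"
    using \<open>1 < q\<close> by (auto simp: q'_def field_simps)
  have "a i * A powr (q - 1) \<le> a i powr q / q + A powr q / q'" if "i \<in> S" for i
    using Youngs_inequality[OF \<open>1 < q\<close> q'(1,2) nonneg[OF that], of "A powr (q - 1)"] q'(3)
    by (simp add: powr_powr)
  then have "(\<Sum>i\<in>S. a i * A powr (q - 1)) \<le> (\<Sum>i\<in>S. a i powr q / q + A powr q / q')"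
    by (rule sum_mono)
  also have "\<dots> = (\<Sum>i\<in>S. a i powr q) / q + n * (A powr q / q')"
    by (simp add: sum.distrib sum_divide_distrib n_def)
  also have "(\<Sum>i\<in>S. a i * A powr (q - 1)) = n * A * A powr (q - 1)"
    using n by (simp add: A_def sum_distrib_right)
  also have "n * A * A powr (q - 1) = n * A powr q"
    using A \<open>1 < q\<close> powr_mult_base[OF A, of "q - 1"] by simp
  finally have *: "n * A powr q \<le> (\<Sum>i\<in>S. a i powr q) / q + n * (A powr q / q')" .
  \<comment> \<open>Substituting this cancels \<open>n * A powr q\<close> in \<open>*\<close> and
    leaves the desired inequality divided by \<open>q\<close>.\<close>
  have "1 / q' = 1 - 1 / q" using q'(2) by simp
  then have "n * A powr q * (1 / q') = n * A powr q - n * A powr q / q"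
    by (simp add: right_diff_distrib)
  with * have "n * A powr q / q \<le> (\<Sum>i\<in>S. a i powr q) / q"
    by simp
  then have "n * A powr q \<le> (\<Sum>i\<in>S. a i powr q)"
    using \<open>1 < q\<close> by (simp add: divide_le_cancel)
  then show ?thesis
    using n by (simp add: A_def[symmetric] n_def[symmetric] field_simps)
qed

text \<open>On a ball of radius \<open>r\<close> the factor \<open>1 / card (tball k x r) \<le> 1 / k ^ r\<close> is at most
  \<open>1 / k ^ tdist k x y\<close>, so all radii obey the same bound.\<close>

lemma ball_average_powr_le:
  assumes "2 \<le> k" "x \<in> tree k" "1 < q"
  shows "(1 / real (card (tball k x r)) * (\<Sum>y\<in>tball k x r. cmod (f y))) powr q
    \<le> (\<Sum>y\<in>tball k x r. cmod (f y) powr q / real k ^ tdist k x y)"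
proof -
  let ?B = "tball k x r"
  have kr: "0 < k ^ r" using assms(1) by simp
  with card_tball_ge[OF assms(2), of r] have "card ?B > 0" by linarith
  then have B: "finite ?B" "?B \<noteq> {}" by (auto simp: card_gt_0_iff)
  have "(1 / real (card ?B) * (\<Sum>y\<in>?B. cmod (f y))) powr q
      \<le> (\<Sum>y\<in>?B. cmod (f y) powr q) / real (card ?B)"
    using mean_powr_le[OF B assms(3), of "\<lambda>y. cmod (f y)"] by simp
  also have "\<dots> = (\<Sum>y\<in>?B. cmod (f y) powr q / real (card ?B))"
    by (rule sum_divide_distrib)
  also have "\<dots> \<le> (\<Sum>y\<in>?B. cmod (f y) powr q / real k ^ tdist k x y)"
  proof (rule sum_mono)
    fix y assume "y \<in> ?B"
    then have "k ^ tdist k x y \<le> k ^ r"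
      using assms(1) by (intro power_increasing) (auto simp: tball_def)
    also note card_tball_ge[OF assms(2)]
    finally have "real k ^ tdist k x y \<le> real (card ?B)"
      by (metis of_nat_le_iff of_nat_power)
    then show "cmod (f y) powr q / real (card ?B) \<le> cmod (f y) powr q / real k ^ tdist k x y"
      using assms(1) \<open>card ?B > 0\<close> by (intro divide_left_mono mult_pos_pos) auto
  qed
  finally show ?thesis .
qed

section \<open>Summing the kernel against the weight\<close>

lemma sum_powers_less_one_le:
  fixes c :: real
  assumes "0 \<le> c" "c < 1"
  shows "(\<Sum>i\<le>n. c ^ i) \<le> 1 / (1 - c)"
  using assms by (simp add: sum_gp0 divide_right_mono)

text \<open>Level \<open>j\<close> contributes \<open>k ^ j\<close> equal terms. With
  \<open>c = b / k\<close> this count cancels and a series of ratio \<open>b\<close>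
  remains.\<close>

lemma sum_length_powers:
  "(\<Sum>u\<in>(\<Union>j\<le>n. level k j). (c::real) ^ length u) = (\<Sum>j\<le>n. (real k * c) ^ j)"
proof -
  have "(\<Sum>u\<in>(\<Union>j\<le>n. level k j). c ^ length u) = (\<Sum>j\<le>n. \<Sum>u\<in>level k j. c ^ length u)"
    by (intro sum.UNION_disjoint) (auto simp: level_eq[symmetric] , auto simp: level_eq)
  also have "\<dots> = (\<Sum>j\<le>n. \<Sum>u\<in>level k j. c ^ j)"
    by (intro sum.cong) (auto simp: level_eq)
  also have "\<dots> = (\<Sum>j\<le>n. (real k * c) ^ j)"
    by (simp add: card_level power_mult_distrib)
  finally show ?thesis .
qed

lemma weight_kernel_bound:
  assumes "2 \<le> k" "0 < \<delta>" "\<delta> < 1" "y \<in> tree k" "finite X" "X \<subseteq> tree k"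
  shows "(\<Sum>x\<in>X. weight k \<delta> x / real k ^ tdist k x y)
    \<le> 1 / (1 - real k powr (\<delta> - 1)) * (1 / (1 - real k powr (- \<delta>))) * weight k \<delta> y"
proof -
  define a where "a = real k powr (\<delta> - 1)"
  define b where "b = real k powr (- \<delta>)"
  have a: "0 \<le> a" "a < 1" and b: "0 \<le> b" "b < 1"
    using assms powr_less_mono[of "\<delta> - 1" 0 "real k"] powr_less_mono[of "- \<delta>" 0 "real k"]
    by (auto simp: a_def b_def)
  \<comment> \<open>Only finitely many levels meet \<open>X\<close>, so a finite set of pairs (i, u)
    suffices as index set.\<close>
  obtain J where J: "\<And>x. x \<in> X \<Longrightarrow> length x \<le> J"
    using finite_imageI[OF \<open>finite X\<close>, of length] by (meson finite_nat_set_iff_bounded_le imageI)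
  let ?U = "\<Union>j\<le>J. level k j"
  \<comment> \<open>Each \<open>x\<close> is charged to a pair realising its distance from
    \<open>y\<close>; all other pairs contribute nonnegative terms.\<close>
  have "(\<Sum>x\<in>X. weight k \<delta> x / real k ^ tdist k x y)
    \<le> (\<Sum>(i, u)\<in>{..length y} \<times> ?U. weight k \<delta> y * (a ^ i * (b / real k) ^ length u))"
  proof (rule sum_le_included[where i = "\<lambda>(i, u). u @ drop i y"])
    show "\<forall>x\<in>X. \<exists>z\<in>{..length y} \<times> ?U. (case z of (i, u) \<Rightarrow> u @ drop i y) = x \<and>
       weight k \<delta> x / real k ^ tdist k x y
         \<le> (case z of (i, u) \<Rightarrow> weight k \<delta> y * (a ^ i * (b / real k) ^ length u))"
    proof
      fix x assume "x \<in> X"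
      then have x: "x \<in> tree k" "length x \<le> J" using assms J by auto
      obtain i u where iu: "i \<le> length y" "u \<in> tree k" "x = u @ drop i y" "tdist k y x = i + length u"
        by (rule tdist_obtain[OF assms(4) x(1)])
      have k: "real k > 0" using assms by simp
      have "weight k \<delta> x / real k ^ tdist k x y
        = real k powr (- \<delta> * (real (length u) + real (length y) - real i) - (real i + real (length u)))"
        using iu(1) k unfolding weight_eq[OF x(1)] tdist_commute[OF x(1) assms(4)] iu(4)
        by (simp add: iu(3) powr_diff of_nat_diff flip: powr_realpow)
      \<comment> \<open>The exponent separates: each upward step contributes the factor
        \<open>a\<close>, each downward step the factor \<open>b / k\<close>.\<close>
      also have "\<dots> = real k powr (- \<delta> * length y + (\<delta> - 1) * real i + (- \<delta> - 1) * real (length u))"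
        by (simp add: algebra_simps)
      also have "\<dots> = weight k \<delta> y * (a ^ i * (b / real k) ^ length u)"
      proof -
        have "b / real k = real k powr (- \<delta> - 1)"
          using k by (simp add: b_def powr_diff)
        then show ?thesis
          using k by (simp add: weight_eq[OF assms(4)] a_def powr_powr algebra_simps flip: powr_realpow powr_add)
      qed
      finally show "\<exists>z\<in>{..length y} \<times> ?U. (case z of (i, u) \<Rightarrow> u @ drop i y) = x \<and>
       weight k \<delta> x / real k ^ tdist k x y
         \<le> (case z of (i, u) \<Rightarrow> weight k \<delta> y * (a ^ i * (b / real k) ^ length u))"
        using iu x by (intro bexI[of _ "(i, u)"]) (auto simp: level_eq)
    qed
  qed (use assms a b in \<open>auto simp: weight_eq\<close>)
  also have "\<dots> = weight k \<delta> y * ((\<Sum>i\<le>length y. a ^ i) * (\<Sum>u\<in>?U. (b / real k) ^ length u))"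
    unfolding sum_product sum.cartesian_product by (simp add: sum_distrib_left case_prod_unfold)
  also have "(\<Sum>u\<in>?U. (b / real k) ^ length u) = (\<Sum>j\<le>J. b ^ j)"
    using assms by (simp add: sum_length_powers)
  also have "weight k \<delta> y * ((\<Sum>i\<le>length y. a ^ i) * (\<Sum>j\<le>J. b ^ j))
    \<le> weight k \<delta> y * (1 / (1 - a) * (1 / (1 - b)))"
    using a b assms
    by (intro mult_left_mono mult_mono sum_powers_less_one_le) (auto simp: weight_eq intro!: sum_nonneg)
  finally show ?thesis
    by (simp add: a_def b_def mult.commute)
qed

section \<open>Powers and infinite sums of extended nonnegative values\<close>

text \<open>If \<open>B\<close> is a finite b, every \<open>a i\<close> is at most b to the power
  1/q, hence so is the supremum. It is then finite, \<open>ennpow\<close> is an ordinary power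
  there, and the q-th power returns b.\<close>

lemma ennpow_SUP_le:
  assumes "0 < q" "\<And>i. 0 \<le> a i" "\<And>i. ennreal (a i powr q) \<le> B"
  shows "ennpow (SUP i. ennreal (a i)) q \<le> B"
proof (cases B)
  case (real b)
  let ?s = "SUP i. ennreal (a i)"
  have le: "?s \<le> ennreal (b powr (1 / q))"
  proof (rule SUP_least)
    fix i
    have "a i powr q \<le> b" using assms(3)[of i] real by simp
    then have "(a i powr q) powr (1 / q) \<le> b powr (1 / q)"
      using assms by (intro powr_mono2) auto
    then show "ennreal (a i) \<le> ennreal (b powr (1 / q))"
      using assms by (simp add: powr_powr)
  qed
  then have "?s \<noteq> \<infinity>"
    using ennreal_less_top leD by fastforce
  then have "ennpow ?s q = ennreal (enn2real ?s powr q)"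
    unfolding ennpow_def by (rule if_not_P)
  moreover have "enn2real ?s powr q \<le> (b powr (1 / q)) powr q"
    using assms by (intro powr_mono2 enn2real_leI le) auto
  moreover have "(b powr (1 / q)) powr q = b"
    using assms real by (simp add: powr_powr)
  ultimately show ?thesis
    using real by (simp add: ennreal_leI)
qed simp

lemma ennpow_mono: "0 < s \<Longrightarrow> a \<le> b \<Longrightarrow> ennpow a s \<le> ennpow b s"
  by (auto simp: ennpow_def top_unique enn2real_mono less_top intro!: ennreal_leI powr_mono2)

text \<open>Moves a constant out of the weighted norm. Positivity of \<open>C\<close> keeps its
  product with infinity infinite.\<close>

lemma ennpow_cmult:
  assumes "0 < C"
  shows "ennpow (ennreal C * b) s = ennreal (C powr s) * ennpow b s"
proof (cases b)
  case (real r)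
  then show ?thesis
    using assms by (simp add: ennpow_def powr_mult enn2real_mult ennreal_mult_eq_top_iff
        flip: ennreal_mult)
qed (use assms in \<open>simp add: ennpow_def ennreal_mult_top\<close>)

lemma summable_ennreal: "(g :: 'a \<Rightarrow> ennreal) summable_on Y"
  by (rule nonneg_summable_on_complete) simp

section \<open>The weighted bound for the maximal function\<close>

text \<open>The sum over a ball is part of the sum over the tree, so the bound is the same for all
  radii and passes to the supremum.\<close>

lemma maximal_fun_powr_le:
  assumes "2 \<le> k" "x \<in> tree k" "1 < q"
  shows "ennpow (maximal_fun k f x) q
    \<le> (\<Sum>\<^sub>\<infinity>y\<in>tree k. ennreal (cmod (f y) powr q / real k ^ tdist k x y))"
  unfolding maximal_fun_def
proof (rule ennpow_SUP_le)
  fix r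
  let ?B = "tball k x r"
  have "ennreal ((1 / real (card ?B) * (\<Sum>y\<in>?B. cmod (f y))) powr q)
    \<le> ennreal (\<Sum>y\<in>?B. cmod (f y) powr q / real k ^ tdist k x y)"
    by (intro ennreal_leI ball_average_powr_le assms)
  also have "\<dots> = (\<Sum>y\<in>?B. ennreal (cmod (f y) powr q / real k ^ tdist k x y))"
    by (intro sum_ennreal[symmetric]) auto
  also have "\<dots> \<le> (\<Sum>\<^sub>\<infinity>y\<in>tree k. ennreal (cmod (f y) powr q / real k ^ tdist k x y))"
    unfolding infsum_finite[OF finite_tball[OF assms(2)], symmetric]
    by (intro infsum_mono_neutral summable_ennreal) (auto simp: tball_def)
  finally show "ennreal ((1 / real (card ?B) * (\<Sum>y\<in>?B. cmod (f y))) powr q)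
    \<le> (\<Sum>\<^sub>\<infinity>y\<in>tree k. ennreal (cmod (f y) powr q / real k ^ tdist k x y))" .
qed (use assms in \<open>auto intro!: divide_nonneg_nonneg sum_nonneg\<close>)

lemma sum_infsum_ennreal_swap:
  fixes g :: "'a \<Rightarrow> 'b \<Rightarrow> ennreal"
  assumes "finite X"
  shows "(\<Sum>x\<in>X. \<Sum>\<^sub>\<infinity>y\<in>Y. g x y) = (\<Sum>\<^sub>\<infinity>y\<in>Y. \<Sum>x\<in>X. g x y)"
  using assms by (induction X) (simp_all add: infsum_add[OF summable_ennreal summable_ennreal])

lemma infsum_cmult_ennreal:
  fixes g :: "'a \<Rightarrow> ennreal"
  shows "(\<Sum>\<^sub>\<infinity>y\<in>Y. c * g y) = c * (\<Sum>\<^sub>\<infinity>y\<in>Y. g y)"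
  by (subst (1 2) nonneg_infsum_complete)
    (auto simp: SUP_mult_left_ennreal sum_distrib_left)

text \<open>Passing to finite partial sums over \<open>X\<close> leaves only a finite sum to
  exchange with an infinite one. For each \<open>y\<close>, \<open>weight_kernel_bound\<close> then
  applies with a constant independent of \<open>X\<close> and \<open>f\<close>. Values in
  \<open>ennreal\<close> also cover an infinite right-hand side.\<close>

lemma infsum_maximal_fun_le:
  assumes "2 \<le> k" "0 < \<delta>" "\<delta> < 1" "1 < q"
  shows "(\<Sum>\<^sub>\<infinity>x\<in>tree k. ennpow (maximal_fun k f x) q * ennreal (weight k \<delta> x))
    \<le> ennreal (1 / (1 - real k powr (\<delta> - 1)) * (1 / (1 - real k powr (- \<delta>))))
       * (\<Sum>\<^sub>\<infinity>y\<in>tree k. ennpow (ennreal (cmod (f y))) q * ennreal (weight k \<delta> y))"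
    (is "_ \<le> ennreal ?C * _")
proof (rule infsum_le_finite_sums)
  fix X assume X: "finite X" "X \<subseteq> tree k"
  have "(\<Sum>x\<in>X. ennpow (maximal_fun k f x) q * ennreal (weight k \<delta> x))
    \<le> (\<Sum>x\<in>X. (\<Sum>\<^sub>\<infinity>y\<in>tree k. ennreal (cmod (f y) powr q / real k ^ tdist k x y))
               * ennreal (weight k \<delta> x))"
    using assms X by (intro sum_mono mult_right_mono maximal_fun_powr_le) auto
  also have "\<dots> = (\<Sum>x\<in>X. \<Sum>\<^sub>\<infinity>y\<in>tree k.
       ennreal (cmod (f y) powr q / real k ^ tdist k x y) * ennreal (weight k \<delta> x))"
    by (simp add: mult.commute[of _ "ennreal (weight k \<delta> _)"] infsum_cmult_ennreal)
  also have "\<dots> = (\<Sum>\<^sub>\<infinity>y\<in>tree k. \<Sum>x\<in>X.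
       ennreal (cmod (f y) powr q / real k ^ tdist k x y) * ennreal (weight k \<delta> x))"
    by (rule sum_infsum_ennreal_swap[OF X(1)])
  also have "\<dots> \<le> (\<Sum>\<^sub>\<infinity>y\<in>tree k.
       ennreal ?C * (ennpow (ennreal (cmod (f y))) q * ennreal (weight k \<delta> y)))"
  proof (intro infsum_mono summable_ennreal)
    fix y assume y: "y \<in> tree k"
    have w: "0 \<le> weight k \<delta> x" if "x \<in> tree k" for x
      using that by (simp add: weight_eq)
    have "(\<Sum>x\<in>X. ennreal (cmod (f y) powr q / real k ^ tdist k x y) * ennreal (weight k \<delta> x))
       = (\<Sum>x\<in>X. ennreal (cmod (f y) powr q * (weight k \<delta> x / real k ^ tdist k x y)))"
      using w X by (intro sum.cong) (auto simp flip: ennreal_mult)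
    also have "\<dots> = ennreal (\<Sum>x\<in>X. cmod (f y) powr q * (weight k \<delta> x / real k ^ tdist k x y))"
      using w X by (intro sum_ennreal) auto
    also have "\<dots> \<le> ennreal (cmod (f y) powr q * (?C * weight k \<delta> y))"
      unfolding sum_distrib_left[symmetric] using assms X y
      by (intro ennreal_leI mult_left_mono weight_kernel_bound) auto
    also have "\<dots> = ennreal ?C * (ennpow (ennreal (cmod (f y))) q * ennreal (weight k \<delta> y))"
    proof -
      have "0 \<le> ?C"
        using assms powr_less_mono[of "\<delta> - 1" 0 "real k"] powr_less_mono[of "- \<delta>" 0 "real k"]
        by simp
      then show ?thesis
        using w[OF y] by (simp add: ennpow_def mult_ac flip: ennreal_mult)
    qed
    finally show "(\<Sum>x\<in>X. ennreal (cmod (f y) powr q / real k ^ tdist k x y) * ennreal (weight k \<delta> x))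
       \<le> ennreal ?C * (ennpow (ennreal (cmod (f y))) q * ennreal (weight k \<delta> y))" .
  qed
  also have "\<dots> = ennreal ?C * (\<Sum>\<^sub>\<infinity>y\<in>tree k. ennpow (ennreal (cmod (f y))) q * ennreal (weight k \<delta> y))"
    by (rule infsum_cmult_ennreal)
  finally show "(\<Sum>x\<in>X. ennpow (maximal_fun k f x) q * ennreal (weight k \<delta> x))
    \<le> ennreal ?C * (\<Sum>\<^sub>\<infinity>y\<in>tree k. ennpow (ennreal (cmod (f y))) q * ennreal (weight k \<delta> y))" .
qed (rule summable_ennreal)

lemma maximal_fun_bounded:
  assumes "2 \<le> k" "0 < \<delta>" "\<delta> < 1" "1 < q"
  shows "\<exists>C::real. C \<ge> 0 \<and> (\<forall>f :: vertex \<Rightarrow> complex.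
               Lnorm k q (weight k \<delta>) (maximal_fun k f)
                 \<le> ennreal C * Lnorm k q (weight k \<delta>) (\<lambda>x. ennreal (cmod (f x))))"
proof -
  define C where "C = 1 / (1 - real k powr (\<delta> - 1)) * (1 / (1 - real k powr (- \<delta>)))"
  have "C > 0"
    using assms powr_less_mono[of "\<delta> - 1" 0 "real k"] powr_less_mono[of "- \<delta>" 0 "real k"]
    by (simp add: C_def)
  \<comment> \<open>The q-th root in the norm turns the constant \<open>C\<close> into
    \<open>C powr (1 / q)\<close>.\<close>
  then have "Lnorm k q (weight k \<delta>) (maximal_fun k f)
      \<le> ennreal (C powr (1 / q)) * Lnorm k q (weight k \<delta>) (\<lambda>x. ennreal (cmod (f x)))" for f
    unfolding Lnorm_def ennpow_cmult[OF \<open>C > 0\<close>, symmetric]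
    using assms infsum_maximal_fun_le[OF assms, of f]
    by (intro ennpow_mono) (auto simp: C_def)
  then show ?thesis
    by (intro exI[of _ "C powr (1 / q)"]) auto
qed

section \<open>Growth of the product of sphere averages\<close>

lemma sphere_avg_product_ge:
  assumes "2 \<le> k" "x \<in> tree k" "length x = n" "1 < p"
  shows "real k powr ((2 * \<delta> - 1) * real n) / 2 powr p
    \<le> sphere_avg k x n (weight k \<delta>)
       * sphere_avg k x n (\<lambda>y. weight k \<delta> y powr (- 1 / (p - 1))) powr (p - 1)"
proof -
  let ?S = "tsphere k x n"
  define K where "K = real k"
  have K: "K > 0" using assms by (simp add: K_def)
  have fin: "finite ?S" by (rule finite_tsphere[OF assms(2)])
  \<comment> \<open>Choosing the radius equal to the depth of \<open>x\<close> puts the root, of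
    weight 1, on the sphere.\<close>
  have root: "[] \<in> ?S"
    using tdist_root[OF assms(2)] assms(3) by (simp add: tsphere_def)
  then have card_pos: "0 < card ?S"
    using fin by (auto simp: card_gt_0_iff)
  have "real (card ?S) \<le> 2 * K ^ n"
    using card_tsphere_le[OF assms(1,2), of n]
    by (metis K_def of_nat_le_iff of_nat_mult of_nat_numeral of_nat_power)
  then have card: "1 / (2 * K ^ n) \<le> 1 / real (card ?S)"
    using card_pos by (intro divide_left_mono) (auto intro!: mult_pos_pos K)
  have w: "0 \<le> weight k \<delta> y" if "y \<in> ?S" for y
    using that by (simp add: weight_eq tsphere_def)
  have "1 \<le> (\<Sum>y\<in>?S. weight k \<delta> y)"
    using member_le_sum[OF root, of "weight k \<delta>"] w fin K by (simp add: weight_eq K_def)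
  then have "1 / (2 * K ^ n) * 1 \<le> 1 / real (card ?S) * (\<Sum>y\<in>?S. weight k \<delta> y)"
    using K by (intro mult_mono card) auto
  then have 1: "1 / (2 * K ^ n) \<le> sphere_avg k x n (weight k \<delta>)"
    by (simp add: sphere_avg_def)
  let ?D = "(\<lambda>u. u @ x) ` level k n"
  let ?v = "\<lambda>y. weight k \<delta> y powr (- 1 / (p - 1))"
  \<comment> \<open>The descendants in \<open>?D\<close> have depth \<open>2 * n\<close>, so the
    negative power of their weight is large.\<close>
  have v: "?v y = K powr (2 * \<delta> * real n / (p - 1))" if "y \<in> ?D" for y
  proof -
    have "y \<in> tree k" "length y = 2 * n"
      using that assms by (auto simp: level_eq)
    then show ?thesis
      by (simp add: weight_eq powr_powr K_def mult_ac)
  qed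
  have "K ^ n * K powr (2 * \<delta> * real n / (p - 1)) = (\<Sum>y\<in>?D. ?v y)"
    using v by (simp add: card_descendants K_def)
  also have "\<dots> \<le> (\<Sum>y\<in>?S. ?v y)"
    using descendants_subset_tsphere[OF assms(2), of n] fin by (intro sum_mono2) auto
  finally have "1 / (2 * K ^ n) * (K ^ n * K powr (2 * \<delta> * real n / (p - 1)))
     \<le> 1 / real (card ?S) * (\<Sum>y\<in>?S. ?v y)"
    using K by (intro mult_mono card) auto
  then have "1 / 2 * K powr (2 * \<delta> * real n / (p - 1)) \<le> sphere_avg k x n ?v"
    using K by (simp add: sphere_avg_def)
  then have "(1 / 2 * K powr (2 * \<delta> * real n / (p - 1))) powr (p - 1) \<le> sphere_avg k x n ?v powr (p - 1)"
    using assms(4) by (intro powr_mono2) auto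
  also have "(1 / 2 * K powr (2 * \<delta> * real n / (p - 1))) powr (p - 1)
      = K powr (2 * \<delta> * real n) / 2 powr (p - 1)"
    using assms(4) K by (simp add: powr_mult powr_powr powr_divide)
  finally have 2: "K powr (2 * \<delta> * real n) / 2 powr (p - 1) \<le> sphere_avg k x n ?v powr (p - 1)" .
  have "1 / (2 * K ^ n) * (K powr (2 * \<delta> * real n) / 2 powr (p - 1))
      \<le> sphere_avg k x n (weight k \<delta>) * sphere_avg k x n ?v powr (p - 1)"
    using K by (intro mult_mono 1 2 order_trans[OF _ 1]) auto
  also have "1 / (2 * K ^ n) * (K powr (2 * \<delta> * real n) / 2 powr (p - 1))
      = K powr ((2 * \<delta> - 1) * real n) / 2 powr p"
    using K by (simp add: powr_diff left_diff_distrib flip: powr_realpow)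
  finally show ?thesis
    by (simp add: K_def)
qed

theorem proposition3p1:
  fixes k :: nat and \<delta> :: real
  assumes "k \<ge> 2" and "1 / 2 < \<delta>" and "\<delta> < 1"
  shows "(\<forall>q::real. 1 < q \<longrightarrow>
            (\<exists>C::real. C \<ge> 0 \<and> (\<forall>f :: vertex \<Rightarrow> complex.
               Lnorm k q (weight k \<delta>) (maximal_fun k f)
                 \<le> ennreal C * Lnorm k q (weight k \<delta>) (\<lambda>x. ennreal (cmod (f x)))))) \<and>
         (\<forall>p::real. 1 < p \<longrightarrow>
            (SUP (x, r) \<in> tree k \<times> {1::nat..}.
               ereal (sphere_avg k x r (weight k \<delta>)
                 * sphere_avg k x r (\<lambda>y. weight k \<delta> y powr (- 1 / (p - 1))) powr (p - 1))) = \<infinity>)"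
proof (intro conjI allI impI)
  fix q :: real assume "1 < q"
  then show "\<exists>C::real. C \<ge> 0 \<and> (\<forall>f :: vertex \<Rightarrow> complex.
               Lnorm k q (weight k \<delta>) (maximal_fun k f)
                 \<le> ennreal C * Lnorm k q (weight k \<delta>) (\<lambda>x. ennreal (cmod (f x))))"
    using assms by (intro maximal_fun_bounded) auto
next
  fix p :: real assume p: "1 < p"
  show "(SUP (x, r) \<in> tree k \<times> {1::nat..}.
               ereal (sphere_avg k x r (weight k \<delta>)
                 * sphere_avg k x r (\<lambda>y. weight k \<delta> y powr (- 1 / (p - 1))) powr (p - 1))) = \<infinity>"
  proof (rule SUP_PInfty)
    fix m :: nat
    define b where "b = real k powr (2 * \<delta> - 1)"
    \<comment> \<open>This is where \<delta> > 1/2 enters.\<close>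
    have b: "1 < b"
      using assms powr_less_mono[of 0 "2 * \<delta> - 1" "real k"] by (simp add: b_def)
    obtain n where n: "real m * 2 powr p < b ^ n"
      using real_arch_pow[OF b] by blast
    \<comment> \<open>Radii start at 1 while \<open>n\<close> may be 0, hence the passage to
      \<open>Suc n\<close>.\<close>
    have "b ^ n \<le> b ^ Suc n"
      using b by (intro power_increasing) auto
    also have "\<dots> = real k powr ((2 * \<delta> - 1) * real (Suc n))"
      using assms unfolding b_def
      by (subst powr_realpow[symmetric]) (simp_all add: powr_powr)
    finally have "real m \<le> real k powr ((2 * \<delta> - 1) * real (Suc n)) / 2 powr p"
      using n by (simp add: pos_le_divide_eq)
    \<comment> \<open>Any vertex of depth \<open>Suc n\<close> would serve; this one follows the
      child numbered 0 throughout.\<close>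
    moreover have "replicate (Suc n) 0 \<in> tree k"
      using assms(1) by (auto simp: tree_def)
    ultimately show "\<exists>z\<in>tree k \<times> {1..}. ereal (real m) \<le> (case z of (x, r) \<Rightarrow>
               ereal (sphere_avg k x r (weight k \<delta>)
                 * sphere_avg k x r (\<lambda>y. weight k \<delta> y powr (- 1 / (p - 1))) powr (p - 1)))"
      using sphere_avg_product_ge[OF assms(1) _ _ p, of "replicate (Suc n) 0" "Suc n" \<delta>]
      by (intro bexI[of _ "(replicate (Suc n) 0, Suc n)"]) auto
  qed
qed

end
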